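(* Let $k\ge1$ be an integer and let $\mathcal{F}_k$ denote the family of graphs that have at most $k$ edges. Then, as $n\to\infty$: (i) If a graph $G$ cannot be made bipartite by the omission of at most $k$ edges, then $\mathrm{AR}_k(n,G)=(1+o(1))\,\mathrm{ex}(n,K_{\chi_{\mathcal{F}_k}(G)})$. (ii) If $\chi(G)=q\ge 3$ and the complete $q$-partite graph $K_{k+1,\dots,k+1}$ (all $q$ classes of size $k+1$) is a subgraph of $G$, then $\mathrm{AR}_k(n,G)=(1+o(1))\,\mathrm{ex}(n,K_q)=(1+o(1))\,\frac{q-2}{2q-2}\,n^2$.
   Context: All graphs are finite and simple. For $n\ge |V(G)|$, $\mathrm{AR}_k(n,G)$ is the smallest positive integer $q$ such that every edge coloring of $K_n$ with at least $q$ colors contains a (not necessarily induced) copy of $G$ in which no color occurs more than $k$ times. For a subgraph $D$ of $G$, $G-D$ is the graph on $V(G)$ obtained by deleting the edges of $D$, and $\chi_{\mathcal{F}_k}(G)=\min\{\chi(G-D): D\subset G,\ D\in\mathcal{F}_k\}$, i.e. the minimum chromatic number obtainable by deleting at most $k$ edges from $G$. $\mathrm{ex}(n,H)$ is the Turán number: the maximum number of edges in an $n$-vertex graph containing no subgraph isomorphic to $H$. *)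

theory Defs
  imports Complex_Main "HOL-Library.Ramsey" "HOL-Library.Landau_Symbols"
begin

record 'a sgraph =
  verts :: "'a set"
  edges :: "'a set set"

definition simple_graph :: "'a sgraph \<Rightarrow> bool" where
  "simple_graph G \<longleftrightarrow> finite (verts G) \<and> edges G \<subseteq> nsets (verts G) 2"

definition complete_graph :: "nat \<Rightarrow> nat sgraph" where
  "complete_graph n = \<lparr>verts = {..<n}, edges = nsets {..<n} 2\<rparr>"

text \<open>The complete \<open>q\<close>-partite graph with all classes of size \<open>m\<close>;
  the \<open>i\<close>-th class is \<open>{i} \<times> {..<m}\<close>.\<close>

definition complete_multipartite :: "nat \<Rightarrow> nat \<Rightarrow> (nat \<times> nat) sgraph" where
  "complete_multipartite q m =
     \<lparr>verts = {..<q} \<times> {..<m},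
      edges = {{u, v} | u v. u \<in> {..<q} \<times> {..<m} \<and> v \<in> {..<q} \<times> {..<m} \<and> fst u \<noteq> fst v}\<rparr>"

definition subgraph :: "'a sgraph \<Rightarrow> 'a sgraph \<Rightarrow> bool" where
  "subgraph D G \<longleftrightarrow> verts D \<subseteq> verts G \<and> edges D \<subseteq> edges G"

definition embedding :: "('a \<Rightarrow> 'b) \<Rightarrow> 'a sgraph \<Rightarrow> 'b sgraph \<Rightarrow> bool" where
  "embedding f H G \<longleftrightarrow> inj_on f (verts H) \<and> f ` verts H \<subseteq> verts G \<and> (\<forall>e\<in>edges H. f ` e \<in> edges G)"

text \<open>\<open>G\<close> has a (not necessarily induced) subgraph isomorphic to \<open>H\<close>.\<close>

definition contains_copy :: "'b sgraph \<Rightarrow> 'a sgraph \<Rightarrow> bool" where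
  "contains_copy G H \<longleftrightarrow> (\<exists>f. embedding f H G)"

definition delete_edges :: "'a sgraph \<Rightarrow> 'a sgraph \<Rightarrow> 'a sgraph" where
  "delete_edges G D = \<lparr>verts = verts G, edges = edges G - edges D\<rparr>"

definition bipartite :: "'a sgraph \<Rightarrow> bool" where
  "bipartite G \<longleftrightarrow>
     (\<exists>A B. A \<union> B = verts G \<and> A \<inter> B = {} \<and> (\<forall>e\<in>edges G. \<exists>a\<in>A. \<exists>b\<in>B. e = {a, b}))"

definition colorable :: "'a sgraph \<Rightarrow> nat \<Rightarrow> bool" where
  "colorable G r \<longleftrightarrow>
     (\<exists>c :: 'a \<Rightarrow> nat. c ` verts G \<subseteq> {..<r} \<and> (\<forall>u v. {u, v} \<in> edges G \<longrightarrow> c u \<noteq> c v))"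

definition chromatic_number :: "'a sgraph \<Rightarrow> nat" where
  "chromatic_number G = (LEAST r. colorable G r)"

definition few_edges :: "nat \<Rightarrow> 'a sgraph set" where
  "few_edges k = {D. simple_graph D \<and> card (edges D) \<le> k}"

definition family_chromatic_number :: "'a sgraph set \<Rightarrow> 'a sgraph \<Rightarrow> nat" where
  "family_chromatic_number F G =
     Min {chromatic_number (delete_edges G D) | D. subgraph D G \<and> D \<in> F}"

text \<open>The set is nonempty as soon as \<open>H\<close> has an edge, in particular for cliques of order at least 2.\<close>

definition turan_number :: "nat \<Rightarrow> 'a sgraph \<Rightarrow> nat" where
  "turan_number n H =
     Max {card (edges G) | G :: nat sgraph.
            simple_graph G \<and> verts G = {..<n} \<and> \<not> contains_copy G H}"

text \<open>An edge coloring of the complete graph on \<open>n\<close> vertices is a function on its edges, and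
  its number of colors is the number of colors that actually occur. Natural numbers suffice as
  colors, since there are finitely many edges. The definition is meaningful for
  \<open>n \<ge> card (verts G)\<close> and \<open>k \<ge> 1\<close>; for smaller \<open>n\<close> its value is irrelevant for the asymptotics.\<close>

definition anti_ramsey :: "nat \<Rightarrow> nat \<Rightarrow> 'a sgraph \<Rightarrow> nat" where
  "anti_ramsey k n G =
     (LEAST q. q > 0 \<and>
        (\<forall>c :: nat set \<Rightarrow> nat. card (c ` edges (complete_graph n)) \<ge> q \<longrightarrow>
           (\<exists>f. embedding f G (complete_graph n) \<and>
                (\<forall>col. card {e \<in> (`) f ` edges G. c e = col} \<le> k))))"

end

theory Submission imports Defs begin

text \<open>Let \<open>r = p + 1\<close> be the least chromatic number that \<open>G\<close> can reach by losing at most \<open>k\<close> edges. The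
  anti-Ramsey number of \<open>G\<close> and the Turan number of the \<open>r\<close>-clique are both asymptotic to
  \<open>(1 - 1/p) n\<^sup>2 / 2\<close>, provided that \<open>p \<ge> 2\<close>.

  The lower bounds come from the balanced complete \<open>p\<close>-partite graph, which contains no \<open>r\<close>-clique. Give
  its edges distinct colors and all remaining edges of the complete graph one common color. A copy of \<open>G\<close>
  in which no color is used more than \<open>k\<close> times loses at most \<open>k\<close> edges when the common color is removed,
  and then becomes \<open>p\<close>-colorable; this is impossible (\<open>anti_ramsey_gt_turan_graph\<close>).

  The upper bounds come from the Erdos-Stone theorem (\<open>erdos_stone\<close>): a graph with
  \<open>(1 - 1/p + \<epsilon>) n\<^sup>2 / 2\<close> edges contains a complete \<open>r\<close>-partite graph with arbitrarily large classes. For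
  the Turan number this is immediate. For the anti-Ramsey number, choose one edge of every color, which
  yields a rainbow complete \<open>r\<close>-partite graph. Some set \<open>D\<close> of at most \<open>k\<close> edges makes \<open>G - D\<close>
  \<open>r\<close>-colorable, and this coloring places \<open>G\<close> into the \<open>r\<close> classes with at most \<open>k\<close> edges inside classes.
  The colors inside classes are not controlled, but a color can be overused only in one very special
  way, and moving a single vertex within its class repairs it (\<open>rainbow_parts_k_bounded_copy\<close>).

  The two parts of the theorem are two ways to guarantee \<open>p \<ge> 2\<close>. In the first part, \<open>r \<le> 2\<close> would mean
  that \<open>G\<close> can be made bipartite. In the second part, \<open>G\<close> contains \<open>k + 1\<close> disjoint cliques of order
  \<open>q = \<chi>(G)\<close>; deleting \<open>k\<close> edges cannot damage all of them, so \<open>r = q\<close>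
  (\<open>family_chromatic_number_multipartite\<close>).\<close>

section \<open>The Erdos-Stone theorem\<close>

definition neighbours :: "'v set set \<Rightarrow> 'v \<Rightarrow> 'v set" where
  "neighbours E v = {u. {u, v} \<in> E}"

text \<open>Disjoint vertex classes are easier to extend by one class than an injective map on
  \<open>{..<p} \<times> {..<t}\<close> is; \<open>complete_parts_contains_copy\<close> below translates the classes into a copy of
  the complete multipartite graph.\<close>

definition complete_parts ::
    "'v set set \<Rightarrow> 'v set \<Rightarrow> nat \<Rightarrow> nat \<Rightarrow> (nat \<Rightarrow> 'v set) \<Rightarrow> bool" where
  "complete_parts E V p t P \<longleftrightarrow>
     (\<forall>i<p. P i \<subseteq> V \<and> card (P i) = t) \<and>
     (\<forall>i<p. \<forall>j<p. i \<noteq> j \<longrightarrow> P i \<inter> P j = {} \<and> (\<forall>u\<in>P i. \<forall>v\<in>P j. {u, v} \<in> E))"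

lemma incidence_double_count:
  assumes "finite A" "finite B"
  shows "(\<Sum>v\<in>A. card (neighbours E v \<inter> B)) = (\<Sum>u\<in>B. card (neighbours E u \<inter> A))"
proof -
  have *: "card (neighbours E v \<inter> C) = (\<Sum>u\<in>C. if {u, v} \<in> E then 1 else 0)"
    if "finite C" for v C
  proof -
    have "neighbours E v \<inter> C = {u \<in> C. {u, v} \<in> E}"
      by (auto simp: neighbours_def)
    then show ?thesis
      using that by (simp add: sum.If_cases Int_def)
  qed
  have "(\<Sum>v\<in>A. card (neighbours E v \<inter> B)) = (\<Sum>v\<in>A. \<Sum>u\<in>B. if {u, v} \<in> E then 1 else 0)"
    using * assms by simp
  also have "\<dots> = (\<Sum>u\<in>B. \<Sum>v\<in>A. if {v, u} \<in> E then 1 else 0)"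
    by (subst sum.swap) (simp add: insert_commute)
  also have "\<dots> = (\<Sum>u\<in>B. card (neighbours E u \<inter> A))"
    using * assms by simp
  finally show ?thesis .
qed

text \<open>A vertex \<open>u\<close> of \<open>W\<close> sees one of at most \<open>2 ^ (q * T)\<close> subsets of the union \<open>K\<close> of the classes. If \<open>W\<close> is
  large, then \<open>t\<close> of its vertices see the same set \<open>S\<close>. These vertices are the new class, and \<open>t\<close>
  vertices of \<open>S\<close> in each old class, which exist because \<open>S\<close> meets every class in at least \<open>t\<close>
  vertices, are the other classes.\<close>

lemma complete_parts_extend:
  assumes P: "complete_parts E V q T P" and "finite V"
    and W: "W \<subseteq> V - (\<Union>i<q. P i)"
    and rich: "\<And>u i. u \<in> W \<Longrightarrow> i < q \<Longrightarrow> t \<le> card (neighbours E u \<inter> P i)"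
    and large: "t * 2 ^ (q * T) \<le> card W"
  shows "\<exists>Q. complete_parts E V (Suc q) t Q"
proof (cases "W = {}")
  case True
  then have "t = 0" using large by simp
  then have "complete_parts E V (Suc q) t (\<lambda>_. {})"
    by (simp add: complete_parts_def)
  then show ?thesis by blast
next
  case False
  define K where "K = (\<Union>i<q. P i)"
  have PV: "P i \<subseteq> V" "card (P i) = T" "finite (P i)" if "i < q" for i
    using P that \<open>finite V\<close> by (auto simp: complete_parts_def intro: finite_subset)
  have finK: "finite K"
    using PV by (auto simp: K_def)
  have cardK: "card K = q * T"
  proof -
    have "card K = (\<Sum>i<q. card (P i))"
      unfolding K_def using P PV by (intro card_UN_disjoint) (auto simp: complete_parts_def)
    then show ?thesis using PV by simp
  qed
  have finW: "finite W"
    using W \<open>finite V\<close> finite_subset by blast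
  have "(\<lambda>u. neighbours E u \<inter> K) \<in> W \<rightarrow> Pow K"
    by auto
  from pigeonhole_card[OF this finW]
  obtain S where S: "S \<in> Pow K"
      "card W \<le> card ((\<lambda>u. neighbours E u \<inter> K) -` {S} \<inter> W) * card (Pow K)"
    using finK by auto
  define F where "F = (\<lambda>u. neighbours E u \<inter> K) -` {S} \<inter> W"
  have "t * 2 ^ (q * T) \<le> card F * 2 ^ (q * T)"
    using le_trans[OF large S(2)] finK cardK by (simp add: F_def card_Pow)
  then have "t \<le> card F" by simp
  then obtain R where R: "R \<subseteq> F" "card R = t" "finite R"
    by (rule obtain_subset_with_card_n)
  have "F \<noteq> {}"
    using S False finW by (auto simp: F_def)
  then obtain w where w: "w \<in> F" by blast
  have S_rich: "t \<le> card (S \<inter> P i)" if "i < q" for i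
  proof -
    have "neighbours E w \<inter> P i = S \<inter> P i"
      using w that by (auto simp: F_def K_def)
    then show ?thesis
      using rich[of w i] w that by (auto simp: F_def)
  qed
  have "\<exists>Q. Q \<subseteq> S \<inter> P i \<and> card Q = t" if "i < q" for i
    by (rule obtain_subset_with_card_n[OF S_rich[OF that]]) blast
  then obtain Q where Q: "\<And>i. i < q \<Longrightarrow> Q i \<subseteq> S \<inter> P i \<and> card (Q i) = t"
    by metis
  have adj: "{u, r} \<in> E" "{r, u} \<in> E" if "u \<in> S" "r \<in> R" for u r
  proof -
    have "u \<in> neighbours E r"
      using that R by (auto simp: F_def)
    then show "{u, r} \<in> E" "{r, u} \<in> E"
      by (auto simp: neighbours_def insert_commute)
  qed
  have RV: "R \<subseteq> V" "R \<inter> K = {}"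
    using R W by (auto simp: F_def K_def)
  have QK: "Q i \<subseteq> K" "Q i \<subseteq> V" "Q i \<subseteq> S" "Q i \<subseteq> P i" "card (Q i) = t" if "i < q" for i
    using Q[OF that] PV[OF that] that by (auto simp: K_def)
  have "complete_parts E V (Suc q) t (Q(q := R))"
    unfolding complete_parts_def
  proof (intro conjI allI impI)
    fix i assume "i < Suc q"
    then show "(Q(q := R)) i \<subseteq> V" "card ((Q(q := R)) i) = t"
      using QK RV R by (auto simp: less_Suc_eq)
  next
    fix i j assume ij: "i < Suc q" "j < Suc q" "i \<noteq> j"
    consider "i < q" "j < q" | "i = q" "j < q" | "i < q" "j = q"
      using ij by linarith
    note cases = this
    show "(Q(q := R)) i \<inter> (Q(q := R)) j = {}"
    proof (cases rule: cases)
      case 1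
      then have "P i \<inter> P j = {}" using P ij by (auto simp: complete_parts_def)
      then show ?thesis using QK(4)[of i] QK(4)[of j] 1 by auto
    qed (use QK(1) RV in fastforce)+
    show "\<forall>u\<in>(Q(q := R)) i. \<forall>v\<in>(Q(q := R)) j. {u, v} \<in> E"
    proof (cases rule: cases)
      case 1
      then have "\<forall>u\<in>P i. \<forall>v\<in>P j. {u, v} \<in> E" using P ij by (auto simp: complete_parts_def)
      then show ?thesis using QK(4)[of i] QK(4)[of j] 1 by auto
    qed (use QK(3) adj in fastforce)+
  qed
  then show ?thesis by blast
qed

text \<open>The inductive form of the Erdos-Stone theorem. The degree condition is multiplied by \<open>p\<close>: it then
  makes sense for \<open>p = 0\<close>, where it holds trivially for small \<open>\<epsilon>\<close>, and it passes from \<open>p + 1\<close> to \<open>p\<close> with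
  the same \<open>\<epsilon>\<close>, because a degree is at most the number of vertices.

  In the induction step, start from \<open>p + 1\<close> large classes of size \<open>T\<close>, and count the edges between their
  union \<open>K\<close> and all \<open>n\<close> vertices. The degree condition gives at least \<open>T (p + \<epsilon>) n\<close> of them. A vertex with
  fewer than \<open>t\<close> neighbours in some class has at most \<open>p T + t\<close> neighbours in \<open>K\<close>, so these vertices
  account for at most \<open>(p T + t) n\<close>. Once \<open>T \<epsilon> > t\<close>, the surplus forces linearly many vertices with \<open>t\<close>
  neighbours in every class, and \<open>complete_parts_extend\<close> applies to them.\<close>

lemma min_degree_complete_parts:
  fixes \<epsilon> :: real
  assumes "\<epsilon> > 0"
  shows "\<exists>N. \<forall>(V::'v set) E. finite V \<and> N \<le> card V \<and>
           (\<forall>v\<in>V. (real p - 1 + \<epsilon>) * card V \<le> real p * card (neighbours E v \<inter> V)) \<longrightarrow>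
           (\<exists>P. complete_parts E V (Suc p) t P)"
proof (induction p arbitrary: t)
  case 0
  show ?case
  proof (rule exI[of _ t], intro allI impI, elim conjE)
    fix V :: "'v set" and E assume "finite V" "t \<le> card V"
    then obtain T where "T \<subseteq> V" "card T = t"
      using obtain_subset_with_card_n by blast
    then have "complete_parts E V (Suc 0) t (\<lambda>_. T)"
      by (simp add: complete_parts_def)
    then show "\<exists>P. complete_parts E V (Suc 0) t P" by blast
  qed
next
  case (Suc p)
  let ?q = "Suc p"
  obtain T :: nat where T: "real t + 1 \<le> real T * \<epsilon>"
    using reals_Archimedean3[OF assms] by (meson less_imp_le)
  from Suc.IH[of T] obtain N where "\<forall>(V::'v set) E. finite V \<and> N \<le> card V \<and>
       (\<forall>v\<in>V. (real p - 1 + \<epsilon>) * card V \<le> real p * card (neighbours E v \<inter> V)) \<longrightarrow>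
       (\<exists>P. complete_parts E V (Suc p) T P)" ..
  then have N: "\<And>(V::'v set) E. finite V \<Longrightarrow> N \<le> card V \<Longrightarrow>
       (\<And>v. v \<in> V \<Longrightarrow> (real p - 1 + \<epsilon>) * card V \<le> real p * card (neighbours E v \<inter> V)) \<Longrightarrow>
       (\<exists>P. complete_parts E V (Suc p) T P)"
    by simp
  \<comment> \<open>The count will give card V <= card W * (q T) for the set W of vertices rich in neighbours.
      The bound M leaves at least t * 2 ^ (q T) vertices in W after the q T vertices of K are removed.\<close>
  define M where "M = ?q * T * (t * 2 ^ (?q * T) + ?q * T)"
  show ?case
  proof (rule exI[of _ "max N M"], intro allI impI, elim conjE)
    fix V :: "'v set" and E
    assume fin: "finite V" and big: "max N M \<le> card V"
      and deg: "\<forall>v\<in>V. (real ?q - 1 + \<epsilon>) * card V \<le> real ?q * card (neighbours E v \<inter> V)"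
    let ?n = "real (card V)"
    have "(real p - 1 + \<epsilon>) * ?n \<le> real p * card (neighbours E v \<inter> V)" if "v \<in> V" for v
    proof -
      have "card (neighbours E v \<inter> V) \<le> card V"
        using fin by (simp add: card_mono)
      then have "real (card (neighbours E v \<inter> V)) \<le> ?n" by simp
      moreover have "(real ?q - 1 + \<epsilon>) * ?n \<le> real ?q * card (neighbours E v \<inter> V)"
        using deg that by blast
      ultimately show ?thesis by (simp add: algebra_simps)
    qed
    then obtain P where P: "complete_parts E V ?q T P"
      using N[of V E] fin big by auto
    define K where "K = (\<Union>i<?q. P i)"
    have PV: "P i \<subseteq> V" "card (P i) = T" "finite (P i)" if "i < ?q" for i
      using P that fin by (auto simp: complete_parts_def intro: finite_subset)
    have KV: "K \<subseteq> V" and finK: "finite K"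
      using PV by (auto simp: K_def)
    have disj: "P i \<inter> P j = {}" if "i < ?q" "j < ?q" "i \<noteq> j" for i j
      using P that by (auto simp: complete_parts_def)
    have cardK: "card (X \<inter> K) = (\<Sum>i<?q. card (X \<inter> P i))" for X
    proof -
      have "X \<inter> K = (\<Union>i<?q. X \<inter> P i)" by (auto simp: K_def)
      then show ?thesis
        using disj PV by (simp only:) (intro card_UN_disjoint, auto)
    qed
    have cK: "card K = ?q * T"
      using cardK[of UNIV] PV by simp
    define W where "W = {u \<in> V. \<forall>i<?q. t \<le> card (neighbours E u \<inter> P i)}"
    have WV: "W \<subseteq> V" "finite W" using fin by (auto simp: W_def)
    have le: "card (neighbours E u \<inter> P i) \<le> T" if "i < ?q" for u i
      using PV[OF that] card_mono[of "P i" "neighbours E u \<inter> P i"] by auto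
    have poor: "card (neighbours E u \<inter> K) \<le> p * T + t" if u: "u \<in> V - W" for u
    proof -
      obtain i where i: "i < ?q" "card (neighbours E u \<inter> P i) < t"
        using u by (auto simp: W_def not_le)
      have "card (neighbours E u \<inter> K) =
          card (neighbours E u \<inter> P i) + (\<Sum>j\<in>{..<?q} - {i}. card (neighbours E u \<inter> P j))"
        unfolding cardK using i by (intro sum.remove) auto
      also have "\<dots> \<le> t + (\<Sum>j\<in>{..<?q} - {i}. T)"
        using i le by (intro add_mono sum_mono) auto
      also have "\<dots> = p * T + t" using i by simp
      finally show ?thesis .
    qed
    have rich: "card (neighbours E u \<inter> K) \<le> ?q * T" for u
      using cK finK card_mono[of K "neighbours E u \<inter> K"] by auto
    have "(\<Sum>v\<in>K. card (neighbours E v \<inter> V)) = (\<Sum>u\<in>V. card (neighbours E u \<inter> K))"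
      using incidence_double_count finK fin by blast
    also have "\<dots> = (\<Sum>u\<in>W. card (neighbours E u \<inter> K)) + (\<Sum>u\<in>V - W. card (neighbours E u \<inter> K))"
      using WV fin by (simp add: sum.subset_diff add.commute)
    also have "\<dots> \<le> (\<Sum>u\<in>W. ?q * T) + (\<Sum>u\<in>V - W. p * T + t)"
      using rich poor by (intro add_mono sum_mono) auto
    also have "\<dots> \<le> card W * (?q * T) + card V * (p * T + t)"
      using card_mono[OF fin, of "V - W"] by (simp add: mult_le_mono1)
    finally have up: "(\<Sum>v\<in>K. card (neighbours E v \<inter> V)) \<le> card W * (?q * T) + card V * (p * T + t)" .
    have "real (card K) * ((real p + \<epsilon>) * ?n) \<le> (\<Sum>v\<in>K. real ?q * card (neighbours E v \<inter> V))"
      using deg KV by (intro sum_bounded_below) auto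
    also have "\<dots> = real ?q * real (\<Sum>v\<in>K. card (neighbours E v \<inter> V))"
      by (simp add: sum_distrib_left)
    finally have "real ?q * (T * ((real p + \<epsilon>) * ?n)) \<le> real ?q * real (\<Sum>v\<in>K. card (neighbours E v \<inter> V))"
      by (simp add: cK algebra_simps)
    then have "T * ((real p + \<epsilon>) * ?n) \<le> real (\<Sum>v\<in>K. card (neighbours E v \<inter> V))"
      by (subst (asm) mult_le_cancel_left_pos) auto
    also have "\<dots> \<le> real (card W * (?q * T) + card V * (p * T + t))"
      using up by (simp only: of_nat_le_iff)
    finally have "(T * \<epsilon> - t) * ?n \<le> real (card W * (?q * T))"
      by (simp add: algebra_simps)
    moreover have "1 * ?n \<le> (T * \<epsilon> - t) * ?n"
      using T by (intro mult_right_mono) auto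
    ultimately have "real (card V) \<le> real (card W * (?q * T))" by linarith
    then have nW: "card V \<le> card W * (?q * T)" by (simp only: of_nat_le_iff)
    have "M \<le> card W * (?q * T)" using nW big by simp
    then have "?q * T * (t * 2 ^ (?q * T) + ?q * T) \<le> ?q * T * card W"
      unfolding M_def by (simp only: mult.commute[of "card W"])
    moreover have "T > 0"
      using T assms by (cases T) auto
    ultimately have "t * 2 ^ (?q * T) + ?q * T \<le> card W"
      by (metis mult_le_cancel1 nat_0_less_mult_iff zero_less_Suc)
    moreover have "card W \<le> card (W - K) + card K"
      by (metis card_Un_le Un_Diff_cancel2 WV(2) card_mono finK finite_Diff finite_UnI le_trans sup_ge1)
    ultimately have "t * 2 ^ (?q * T) \<le> card (W - K)"
      using cK by linarith
    then show "\<exists>P. complete_parts E V (Suc ?q) t P"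
    proof (rule complete_parts_extend[OF P fin, rotated 2])
      show "W - K \<subseteq> V - (\<Union>i<?q. P i)"
        unfolding K_def using WV(1) by blast
    qed (simp add: W_def)
  qed
qed

lemma edges_remove_vertex:
  assumes "finite V" "v \<in> V"
  shows "card (E \<inter> nsets V 2) \<le> card (E \<inter> nsets (V - {v}) 2) + card (neighbours E v \<inter> V)"
proof -
  have "E \<inter> nsets V 2 \<subseteq> (E \<inter> nsets (V - {v}) 2) \<union> (\<lambda>u. {u, v}) ` (neighbours E v \<inter> V)"
  proof
    fix e assume e: "e \<in> E \<inter> nsets V 2"
    then obtain x y where xy: "e = {x, y}" "x \<noteq> y" "x \<in> V" "y \<in> V"
      by (auto simp: nsets_2_eq)
    show "e \<in> (E \<inter> nsets (V - {v}) 2) \<union> (\<lambda>u. {u, v}) ` (neighbours E v \<inter> V)"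
    proof (cases "v = x \<or> v = y")
      case True
      then obtain u where "e = {u, v}" "u \<in> V" using xy by (auto simp: insert_commute)
      then show ?thesis using e by (auto simp: neighbours_def)
    next
      case False
      then show ?thesis using e xy by auto
    qed
  qed
  then have "card (E \<inter> nsets V 2) \<le>
      card ((E \<inter> nsets (V - {v}) 2) \<union> (\<lambda>u. {u, v}) ` (neighbours E v \<inter> V))"
    using assms by (intro card_mono) (auto intro: finite_imp_finite_nsets)
  also have "\<dots> \<le> card (E \<inter> nsets (V - {v}) 2) + card ((\<lambda>u. {u, v}) ` (neighbours E v \<inter> V))"
    by (rule card_Un_le)
  also have "\<dots> \<le> card (E \<inter> nsets (V - {v}) 2) + card (neighbours E v \<inter> V)"
    using assms by (simp add: card_image_le)
  finally show ?thesis .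
qed

lemma card_nsets_2_le: "2 * card (nsets V 2) \<le> card V ^ 2"
proof -
  have "2 * card (nsets V 2) \<le> card V * (card V - 1)"
    by (simp add: card_nsets choose_two)
  also have "\<dots> \<le> card V ^ 2"
    by (simp add: power2_eq_square)
  finally show ?thesis .
qed

text \<open>Deleting a vertex of degree below \<open>\<alpha> n\<close> costs fewer edges than the bound \<open>\<alpha> n (n + 1) / 2\<close> loses when
  \<open>n\<close> drops by one. So the edge condition survives the deletion of low-degree vertices, and the process
  stops. The surplus of \<open>M\<^sup>2\<close> edges is never spent, and a set with that many edges has at least \<open>M\<close>
  vertices.\<close>

lemma dense_subset_min_degree:
  fixes \<alpha> :: real
  assumes "0 \<le> \<alpha>" "finite V"
    and "\<alpha> * (card V * (card V + 1)) / 2 + real M ^ 2 \<le> card (E \<inter> nsets V 2)"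
  shows "\<exists>U\<subseteq>V. M \<le> card U \<and> (\<forall>v\<in>U. \<alpha> * card U \<le> card (neighbours E v \<inter> U))"
  using assms(2,3)
proof (induction "card V" arbitrary: V)
  case 0
  then show ?case by (auto simp: nsets_eq_empty)
next
  case (Suc n)
  show ?case
  proof (cases "\<forall>v\<in>V. \<alpha> * card V \<le> card (neighbours E v \<inter> V)")
    case True
    have "real M ^ 2 \<le> \<alpha> * (card V * (card V + 1)) / 2 + real M ^ 2"
      using \<open>0 \<le> \<alpha>\<close> by simp
    also have "\<dots> \<le> real (card (E \<inter> nsets V 2))"
      by (rule Suc.prems)
    finally have "M ^ 2 \<le> card (E \<inter> nsets V 2)"
      by (metis of_nat_le_iff of_nat_power)
    also have "\<dots> \<le> card (nsets V 2)"
      using Suc.prems by (intro card_mono) (auto intro: finite_imp_finite_nsets)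
    also have "\<dots> \<le> card V ^ 2"
      using card_nsets_2_le[of V] by linarith
    finally have "M \<le> card V" by (simp add: power2_nat_le_eq_le)
    then show ?thesis using True by blast
  next
    case False
    then obtain v where v: "v \<in> V" "card (neighbours E v \<inter> V) < \<alpha> * card V"
      by (auto simp: not_le)
    have n: "card (V - {v}) = n" using v Suc.hyps Suc.prems by simp
    have "real (card (E \<inter> nsets V 2)) \<le> card (E \<inter> nsets (V - {v}) 2) + card (neighbours E v \<inter> V)"
      using edges_remove_vertex[OF Suc.prems(1) v(1), of E] by linarith
    then have "\<alpha> * (card (V - {v}) * (card (V - {v}) + 1)) / 2 + real M ^ 2
        \<le> card (E \<inter> nsets (V - {v}) 2)"
      using Suc.prems(2) v(2) unfolding n Suc.hyps(2)[symmetric] by (simp add: field_simps)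
    then have "\<exists>U\<subseteq>V - {v}. M \<le> card U \<and> (\<forall>v\<in>U. \<alpha> * card U \<le> card (neighbours E v \<inter> U))"
      using Suc.hyps(1)[of "V - {v}"] n Suc.prems(1) by simp
    then show ?thesis by blast
  qed
qed

lemma complete_parts_contains_copy:
  assumes P: "complete_parts (edges H) (verts H) q t P" and "finite (verts H)"
  shows "contains_copy H (complete_multipartite q t)"
proof -
  have fin: "finite (P i)" "card (P i) = t" "P i \<subseteq> verts H" if "i < q" for i
    using P that \<open>finite (verts H)\<close> by (auto simp: complete_parts_def intro: finite_subset)
  have "\<exists>h. bij_betw h {..<t} (P i)" if "i < q" for i
    using ex_bij_betw_nat_finite[OF fin(1)[OF that]] fin(2)[OF that] by (simp add: lessThan_atLeast0)
  then obtain h where h: "\<And>i. i < q \<Longrightarrow> bij_betw (h i) {..<t} (P i)"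
    by metis
  have hP: "h i j \<in> P i" if "i < q" "j < t" for i j
    using h[OF that(1)] that(2) by (auto simp: bij_betw_def)
  have "embedding (\<lambda>(i, j). h i j) (complete_multipartite q t) H"
    unfolding embedding_def
  proof (intro conjI)
    show "inj_on (\<lambda>(i, j). h i j) (verts (complete_multipartite q t))"
    proof (rule inj_onI, clarsimp simp: complete_multipartite_def)
      fix a b c d assume *: "h a b = h c d" "a < q" "b < t" "c < q" "d < t"
      have "a = c"
        using P hP[of a b] hP[of c d] * unfolding complete_parts_def
        by (metis disjoint_iff)
      then show "a = c \<and> b = d"
        using h[of a] * by (auto simp: bij_betw_def inj_on_def)
    qed
    show "(\<lambda>(i, j). h i j) ` verts (complete_multipartite q t) \<subseteq> verts H"
      using hP fin(3) by (fastforce simp: complete_multipartite_def)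
    show "\<forall>e\<in>edges (complete_multipartite q t). (\<lambda>(i, j). h i j) ` e \<in> edges H"
      using P hP by (auto simp: complete_multipartite_def complete_parts_def)
  qed
  then show ?thesis by (auto simp: contains_copy_def)
qed

text \<open>The density of a graph is traded for a minimum degree on a large vertex set. Passing from \<open>n\<^sup>2\<close> to
  \<open>n (n + 1)\<close> and adding \<open>M\<^sup>2\<close> edges costs lower-order terms, which half of \<open>\<epsilon> n\<^sup>2\<close> pays for.\<close>

theorem erdos_stone:
  fixes \<epsilon> :: real
  assumes "\<epsilon> > 0" "p \<ge> 1"
  shows "\<exists>N. \<forall>H::'v sgraph. simple_graph H \<and> N \<le> card (verts H) \<and>
           ((real p - 1) / (2 * real p) + \<epsilon>) * real (card (verts H)) ^ 2 \<le> card (edges H) \<longrightarrow>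
           contains_copy H (complete_multipartite (Suc p) t)"
proof -
  from min_degree_complete_parts[OF assms(1), of p t]
  obtain M where "\<forall>(V::'v set) E. finite V \<and> M \<le> card V \<and>
       (\<forall>v\<in>V. (real p - 1 + \<epsilon>) * card V \<le> real p * card (neighbours E v \<inter> V)) \<longrightarrow>
       (\<exists>P. complete_parts E V (Suc p) t P)" ..
  then have M: "\<And>(V::'v set) E. finite V \<Longrightarrow> M \<le> card V \<Longrightarrow>
       (\<And>v. v \<in> V \<Longrightarrow> (real p - 1 + \<epsilon>) * card V \<le> real p * card (neighbours E v \<inter> V)) \<Longrightarrow>
       (\<exists>P. complete_parts E V (Suc p) t P)"
    by simp
  \<comment> \<open>The degree ratio that min_degree_complete_parts asks for, divided by p.\<close>
  define \<alpha> where "\<alpha> = (real p - 1 + \<epsilon>) / real p"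
  have \<alpha>: "0 \<le> \<alpha>" "real p * \<alpha> = real p - 1 + \<epsilon>"
    using assms by (auto simp: \<alpha>_def)
  obtain N1 :: nat where N1: "\<alpha> \<le> real N1 * (\<epsilon> / 2)"
    using reals_Archimedean3[of "\<epsilon> / 2"] assms by (meson half_gt_zero less_imp_le)
  obtain N2 :: nat where N2: "real M ^ 2 \<le> real N2 * (\<epsilon> / 4)"
    using reals_Archimedean3[of "\<epsilon> / 4"] assms by (meson zero_less_divide_iff zero_less_numeral less_imp_le)
  show ?thesis
  proof (intro exI[of _ "max N1 (max N2 1)"] allI impI, elim conjE)
    fix H :: "'v sgraph"
    assume H: "simple_graph H" and big: "max N1 (max N2 1) \<le> card (verts H)"
      and dense: "((real p - 1) / (2 * real p) + \<epsilon>) * real (card (verts H)) ^ 2 \<le> card (edges H)"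
    define n where "n = real (card (verts H))"
    have n: "1 \<le> n" "real N1 \<le> n" "real N2 \<le> n"
      using big by (auto simp: n_def)
    have n2: "n \<le> n ^ 2" using n(1) by (simp add: power2_eq_square)
    have "\<alpha> * n \<le> (n * (\<epsilon> / 2)) * n"
      using N1 n assms by (intro mult_right_mono order_trans[OF N1]) auto
    then have a1: "\<alpha> * n / 2 \<le> \<epsilon> / 4 * n ^ 2"
      by (simp add: power2_eq_square algebra_simps)
    have "real N2 * (\<epsilon> / 4) \<le> n ^ 2 * (\<epsilon> / 4)"
      using n n2 assms by (intro mult_right_mono) auto
    then have a2: "real M ^ 2 \<le> \<epsilon> / 4 * n ^ 2"
      using N2 by (simp add: mult.commute)
    have "\<epsilon> / (2 * real p) \<le> \<epsilon> / 2"
      using assms by (intro divide_left_mono) auto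
    moreover have "\<alpha> / 2 = (real p - 1) / (2 * real p) + \<epsilon> / (2 * real p)"
      using assms by (simp add: \<alpha>_def field_simps)
    ultimately have "\<alpha> / 2 \<le> (real p - 1) / (2 * real p) + \<epsilon> / 2" by linarith
    then have "\<alpha> / 2 * n ^ 2 \<le> ((real p - 1) / (2 * real p) + \<epsilon> / 2) * n ^ 2"
      by (intro mult_right_mono) auto
    moreover have "\<alpha> * (n * (n + 1)) / 2 = \<alpha> / 2 * n ^ 2 + \<alpha> * n / 2"
      by (simp add: algebra_simps power2_eq_square)
    moreover have "((real p - 1) / (2 * real p) + \<epsilon>) * n ^ 2
        = ((real p - 1) / (2 * real p) + \<epsilon> / 2) * n ^ 2 + \<epsilon> / 4 * n ^ 2 + \<epsilon> / 4 * n ^ 2"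
      by (simp add: distrib_right)
    ultimately have "\<alpha> * (n * (n + 1)) / 2 + real M ^ 2 \<le> ((real p - 1) / (2 * real p) + \<epsilon>) * n ^ 2"
      using a1 a2 by linarith
    also have "\<dots> \<le> card (edges H \<inter> nsets (verts H) 2)"
      using dense H by (simp add: n_def simple_graph_def Int_absorb2)
    finally have "\<exists>U\<subseteq>verts H. M \<le> card U \<and>
        (\<forall>v\<in>U. \<alpha> * card U \<le> card (neighbours (edges H) v \<inter> U))"
      using H unfolding n_def simple_graph_def
      by (intro dense_subset_min_degree[OF \<alpha>(1)]) (simp_all only: of_nat_mult of_nat_add of_nat_1)
    then obtain U where U: "U \<subseteq> verts H" "M \<le> card U"
        "\<forall>v\<in>U. \<alpha> * card U \<le> card (neighbours (edges H) v \<inter> U)"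
      by blast
    have "(real p - 1 + \<epsilon>) * card U \<le> real p * card (neighbours (edges H) v \<inter> U)" if "v \<in> U" for v
    proof -
      have "real p * (\<alpha> * card U) \<le> real p * card (neighbours (edges H) v \<inter> U)"
        using U(3) that by (intro mult_left_mono) auto
      then show ?thesis by (simp add: \<alpha>(2) mult.assoc[symmetric])
    qed
    moreover have "finite U"
      using U(1) H finite_subset by (auto simp: simple_graph_def)
    ultimately obtain P where "complete_parts (edges H) U (Suc p) t P"
      using M[of U "edges H"] U(2) by blast
    then have "complete_parts (edges H) (verts H) (Suc p) t P"
      using U(1) by (auto simp: complete_parts_def)
    then show "contains_copy H (complete_multipartite (Suc p) t)"
      using complete_parts_contains_copy H by (auto simp: simple_graph_def)
  qed
qed

section \<open>Turan graphs and Turan numbers of cliques\<close>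

text \<open>The Turan number and the anti-Ramsey number are compared with the same quadratic function: the Turan
  graph gives the lower bound for all \<open>n\<close>, the Erdos-Stone theorem the upper bound for large \<open>n\<close>.\<close>

lemma asymp_equiv_quadraticI:
  fixes f :: "nat \<Rightarrow> real"
  assumes "C > 0"
    and lower: "\<And>n. C * (real n * (real n - 1)) \<le> f n"
    and upper: "\<And>\<epsilon>. \<epsilon> > 0 \<Longrightarrow> eventually (\<lambda>n. f n \<le> (C + \<epsilon>) * real n ^ 2) at_top"
  shows "f \<sim>[at_top] (\<lambda>n. C * real n ^ 2)"
proof (rule asymp_equivI', rule order_tendstoI)
  fix a :: real assume a: "a < 1"
  have "(\<lambda>n. 1 - 1 / real n) \<longlonglongrightarrow> 1 - 0"
    by (intro tendsto_intros lim_1_over_n)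
  then have "eventually (\<lambda>n. a < 1 - 1 / real n) at_top"
    using a by (simp add: order_tendsto_iff)
  then show "eventually (\<lambda>n. a < f n / (C * real n ^ 2)) at_top"
    using eventually_gt_at_top[of 0]
  proof eventually_elim
    case (elim n)
    have "1 - 1 / real n = C * (real n * (real n - 1)) / (C * real n ^ 2)"
      using elim assms(1) by (simp add: field_simps power2_eq_square)
    also have "\<dots> \<le> f n / (C * real n ^ 2)"
      using lower assms(1) by (intro divide_right_mono) auto
    finally show ?case using elim by linarith
  qed
next
  fix a :: real assume a: "a > 1"
  then have "C * (a - 1) / 2 > 0" using assms(1) by simp
  from upper[OF this] eventually_gt_at_top[of 0]
  show "eventually (\<lambda>n. f n / (C * real n ^ 2) < a) at_top"
  proof eventually_elim
    case (elim n)
    have "C + C * (a - 1) / 2 < a * C"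
      using mult_strict_right_mono[OF a assms(1)] by (simp add: field_simps)
    then have "(C + C * (a - 1) / 2) * real n ^ 2 < (a * C) * real n ^ 2"
      using elim by (intro mult_strict_right_mono) auto
    then have "f n < a * (C * real n ^ 2)"
      using elim(1) by (simp only: mult.assoc)
    then show ?case
      using elim assms(1) by (simp add: pos_divide_less_eq)
  qed
qed

text \<open>The classes are the residues modulo \<open>p\<close>, which makes them balanced without any case distinction on
  \<open>n mod p\<close>.\<close>

definition turan_graph :: "nat \<Rightarrow> nat \<Rightarrow> nat sgraph" where
  "turan_graph n p = \<lparr>verts = {..<n}, edges = {{i, j} | i j. i < j \<and> j < n \<and> i mod p \<noteq> j mod p}\<rparr>"

lemma turan_graph_edge_iff:
  "{i, j} \<in> edges (turan_graph n p) \<longleftrightarrow> i < n \<and> j < n \<and> i mod p \<noteq> j mod p"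
proof
  assume "i < n \<and> j < n \<and> i mod p \<noteq> j mod p"
  then show "{i, j} \<in> edges (turan_graph n p)"
    by (cases i j rule: linorder_cases) (fastforce simp: turan_graph_def doubleton_eq_iff)+
qed (auto simp: turan_graph_def doubleton_eq_iff)

lemma turan_graph_simple: "simple_graph (turan_graph n p)"
  by (auto simp: simple_graph_def turan_graph_def)

lemma turan_graph_edges_subset: "edges (turan_graph n p) \<subseteq> edges (complete_graph n)"
  using turan_graph_simple[of n p] by (simp add: simple_graph_def turan_graph_def complete_graph_def)

text \<open>Vertex \<open>j\<close> has exactly \<open>j div p\<close> smaller vertices in its own class. Summing \<open>j - j / p\<close> over \<open>j\<close> gives
  the bound.\<close>

lemma card_turan_graph_edges_ge:
  assumes "p \<ge> 1"
  shows "(real p - 1) / (2 * real p) * (real n * (real n - 1)) \<le> card (edges (turan_graph n p))"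
proof -
  let ?S = "\<lambda>j. {i. i < j \<and> i mod p \<noteq> j mod p}"
  have fibre: "real j * ((real p - 1) / real p) \<le> card (?S j)" for j
  proof -
    have "card {i. i < j \<and> i mod p = j mod p} \<le> card ((\<lambda>d. j mod p + p * d) ` {..<j div p})"
    proof (rule card_mono)
      show "{i. i < j \<and> i mod p = j mod p} \<subseteq> (\<lambda>d. j mod p + p * d) ` {..<j div p}"
      proof
        fix i assume i: "i \<in> {i. i < j \<and> i mod p = j mod p}"
        have "i div p \<noteq> j div p"
          using i mod_mult_div_eq[of i p] mod_mult_div_eq[of j p] by auto
        then have "i div p < j div p"
          using i div_le_mono[of i j p] by auto
        moreover have "i = j mod p + p * (i div p)"
          using i mod_mult_div_eq[of i p] by simp
        ultimately show "i \<in> (\<lambda>d. j mod p + p * d) ` {..<j div p}" by blast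
      qed
    qed auto
    also have "\<dots> \<le> j div p"
      using card_image_le[of "{..<j div p}" "\<lambda>d. j mod p + p * d"] by simp
    finally have "real (card {i. i < j \<and> i mod p = j mod p}) \<le> real (j div p)"
      by simp
    moreover have "real (j div p) \<le> real j / real p"
      using of_nat_mono[OF div_times_less_eq_dividend[of j p], where ?'a = real] assms
      by (simp add: pos_le_divide_eq)
    ultimately have same: "real (card {i. i < j \<and> i mod p = j mod p}) \<le> real j / real p"
      by linarith
    have "{..<j} = ?S j \<union> {i. i < j \<and> i mod p = j mod p}" by auto
    then have "card {..<j} = card (?S j) + card {i. i < j \<and> i mod p = j mod p}"
      by (simp only:) (rule card_Un_disjoint, auto)
    then have "real j = card (?S j) + card {i. i < j \<and> i mod p = j mod p}"
      by (metis card_lessThan of_nat_add)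
    then show ?thesis
      using same assms by (simp add: field_simps)
  qed
  have inj: "inj_on (\<lambda>(j, i). {i, j}) (SIGMA j:{..<n}. ?S j)"
    by (auto simp: inj_on_def doubleton_eq_iff)
  have "edges (turan_graph n p) = (\<lambda>(j, i). {i, j}) ` (SIGMA j:{..<n}. ?S j)"
    by (auto simp: turan_graph_def image_iff)
  then have "card (edges (turan_graph n p)) = (\<Sum>j<n. card (?S j))"
    by (simp add: card_image[OF inj])
  moreover have "(\<Sum>j<n. real j * ((real p - 1) / real p)) \<le> (\<Sum>j<n. real (card (?S j)))"
    by (intro sum_mono fibre)
  moreover have "(\<Sum>j<n. real j * ((real p - 1) / real p)) = (real p - 1) / (2 * real p) * (real n * (real n - 1))"
  proof -
    have gauss: "(\<Sum>j<n. real j) = real n * (real n - 1) / 2"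
      by (induction n) (auto simp: field_simps)
    have "(\<Sum>j<n. real j * ((real p - 1) / real p)) = (\<Sum>j<n. real j) * ((real p - 1) / real p)"
      by (rule sum_distrib_right[symmetric])
    then show ?thesis unfolding gauss by simp
  qed
  ultimately show ?thesis by simp
qed

lemma embedding_comp:
  assumes "embedding f F G" "embedding g G H"
  shows "embedding (g \<circ> f) F H"
proof -
  have "inj_on (g \<circ> f) (verts F)"
    using assms by (auto simp: embedding_def intro: comp_inj_on inj_on_subset)
  then show ?thesis
    using assms by (auto simp: embedding_def image_comp[symmetric] simp del: o_apply)
qed

text \<open>One vertex from each class.\<close>

lemma complete_multipartite_contains_clique:
  assumes "t \<ge> 1"
  shows "contains_copy (complete_multipartite q t) (complete_graph q)"
  unfolding contains_copy_def
proof
  show "embedding (\<lambda>i. (i, 0)) (complete_graph q) (complete_multipartite q t)"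
    using assms unfolding embedding_def complete_graph_def complete_multipartite_def
    by (fastforce simp: inj_on_def nsets_2_eq)
qed

lemma turan_graph_clique_free:
  assumes "p \<ge> 1"
  shows "\<not> contains_copy (turan_graph n p) (complete_graph (Suc p))"
proof
  assume "contains_copy (turan_graph n p) (complete_graph (Suc p))"
  then obtain f where f: "embedding f (complete_graph (Suc p)) (turan_graph n p)"
    by (auto simp: contains_copy_def)
  have "inj_on (\<lambda>i. f i mod p) {..<Suc p}"
  proof (rule inj_onI, rule ccontr)
    fix i j assume ij: "i \<in> {..<Suc p}" "j \<in> {..<Suc p}" "f i mod p = f j mod p" "i \<noteq> j"
    then have "{i, j} \<in> edges (complete_graph (Suc p))" by (simp add: complete_graph_def)
    then have "f ` {i, j} \<in> edges (turan_graph n p)"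
      using f unfolding embedding_def by blast
    then show False using ij turan_graph_edge_iff by simp
  qed
  moreover have "(\<lambda>i. f i mod p) ` {..<Suc p} \<subseteq> {..<p}"
    using assms by auto
  ultimately have "card {..<Suc p} \<le> card {..<p}"
    by (intro card_inj_on_le) auto
  then show False by simp
qed

lemma finite_edge_counts:
  "finite {card (edges G) | G :: nat sgraph. simple_graph G \<and> verts G = {..<n} \<and> \<not> contains_copy G H}"
proof (rule finite_subset)
  show "{card (edges G) | G :: nat sgraph. simple_graph G \<and> verts G = {..<n} \<and> \<not> contains_copy G H}
      \<subseteq> card ` Pow (nsets {..<n} 2)"
    by (auto simp: simple_graph_def)
qed (simp add: finite_imp_finite_nsets)

lemma turan_number_ge:
  assumes "simple_graph G" "verts G = {..<n}" "\<not> contains_copy G H"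
  shows "card (edges G) \<le> turan_number n H"
  unfolding turan_number_def using assms by (intro Max_ge finite_edge_counts) auto

lemma turan_number_attained:
  assumes "simple_graph G0" "verts G0 = {..<n}" "\<not> contains_copy G0 H"
  obtains G :: "nat sgraph"
  where "simple_graph G" "verts G = {..<n}" "\<not> contains_copy G H" "card (edges G) = turan_number n H"
proof -
  let ?S = "{card (edges G) | G :: nat sgraph. simple_graph G \<and> verts G = {..<n} \<and> \<not> contains_copy G H}"
  have "?S \<noteq> {}" using assms by blast
  then have "turan_number n H \<in> ?S"
    unfolding turan_number_def by (intro Max_in finite_edge_counts)
  then show ?thesis using that by auto
qed

text \<open>An extremal graph with too many edges would contain, by the Erdos-Stone theorem, the complete
  multipartite graph with classes of size one, which is the clique.\<close>

theorem turan_number_clique_asymp: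
  assumes "p \<ge> 2"
  shows "(\<lambda>n. real (turan_number n (complete_graph (Suc p)))) \<sim>[at_top]
         (\<lambda>n. (real p - 1) / (2 * real p) * real n ^ 2)"
proof (rule asymp_equiv_quadraticI)
  show "(real p - 1) / (2 * real p) > 0" using assms by simp
next
  fix n
  have "card (edges (turan_graph n p)) \<le> turan_number n (complete_graph (Suc p))"
    using assms by (intro turan_number_ge turan_graph_simple turan_graph_clique_free)
      (auto simp: turan_graph_def)
  then show "(real p - 1) / (2 * real p) * (real n * (real n - 1))
      \<le> real (turan_number n (complete_graph (Suc p)))"
    using card_turan_graph_edges_ge[of p n] assms by linarith
next
  fix \<epsilon> :: real assume "\<epsilon> > 0"
  have "p \<ge> 1" using assms by simp
  from erdos_stone[OF \<open>\<epsilon> > 0\<close> this, of 1]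
  obtain N where "\<forall>H::nat sgraph. simple_graph H \<and> N \<le> card (verts H) \<and>
           ((real p - 1) / (2 * real p) + \<epsilon>) * real (card (verts H)) ^ 2 \<le> card (edges H) \<longrightarrow>
           contains_copy H (complete_multipartite (Suc p) 1)" ..
  then have N: "\<And>H::nat sgraph. simple_graph H \<Longrightarrow> N \<le> card (verts H) \<Longrightarrow>
           ((real p - 1) / (2 * real p) + \<epsilon>) * real (card (verts H)) ^ 2 \<le> card (edges H) \<Longrightarrow>
           contains_copy H (complete_multipartite (Suc p) 1)" by simp
  have "real (turan_number n (complete_graph (Suc p))) \<le> ((real p - 1) / (2 * real p) + \<epsilon>) * real n ^ 2"
    if "n \<ge> N" for n
  proof -
    obtain G where G: "simple_graph G" "verts G = {..<n}" "\<not> contains_copy G (complete_graph (Suc p))"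
        "card (edges G) = turan_number n (complete_graph (Suc p))"
      using turan_number_attained[OF turan_graph_simple[of n p] _ turan_graph_clique_free]
        assms by (auto simp: turan_graph_def)
    have "\<not> contains_copy G (complete_multipartite (Suc p) 1)"
      using complete_multipartite_contains_clique[of 1 "Suc p"] embedding_comp G(3)
      unfolding contains_copy_def by blast
    then show ?thesis
      using N[of G] G that by fastforce
  qed
  then show "eventually (\<lambda>n. real (turan_number n (complete_graph (Suc p)))
      \<le> ((real p - 1) / (2 * real p) + \<epsilon>) * real n ^ 2) at_top"
    by (auto simp: eventually_at_top_linorder)
qed

section \<open>Chromatic numbers after the deletion of edges\<close>

lemma colorable_card_verts:
  assumes "simple_graph G"
  shows "colorable (delete_edges G D) (card (verts G))"
proof -
  have fin: "finite (verts G)" using assms by (simp add: simple_graph_def)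
  then obtain h where h: "bij_betw h (verts G) {0..<card (verts G)}"
    using ex_bij_betw_finite_nat by blast
  have "h u \<noteq> h v" if "{u, v} \<in> edges G" for u v
  proof -
    have "{u, v} \<in> nsets (verts G) 2" using that assms unfolding simple_graph_def by blast
    then show ?thesis using h by (auto simp: bij_betw_def inj_on_def)
  qed
  then show ?thesis
    using h unfolding colorable_def
    by (intro exI[of _ h]) (auto simp: delete_edges_def bij_betw_def)
qed

lemma colorable_chromatic_number:
  assumes "simple_graph G"
  shows "colorable (delete_edges G D) (chromatic_number (delete_edges G D))"
  unfolding chromatic_number_def using colorable_card_verts[OF assms] by (rule LeastI)

lemma colorable_mono: "colorable G r \<Longrightarrow> r \<le> s \<Longrightarrow> colorable G s"
  unfolding colorable_def by (meson dual_order.trans lessThan_subset_iff)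

lemma chromatic_number_le: "colorable G r \<Longrightarrow> chromatic_number G \<le> r"
  unfolding chromatic_number_def by (rule Least_le)

lemma bipartite_iff_colorable_2:
  assumes "simple_graph G"
  shows "bipartite (delete_edges G D) \<longleftrightarrow> colorable (delete_edges G D) 2"
proof
  assume "bipartite (delete_edges G D)"
  then obtain A B where AB: "A \<union> B = verts G" "A \<inter> B = {}"
      "\<forall>e\<in>edges G - edges D. \<exists>a\<in>A. \<exists>b\<in>B. e = {a, b}"
    by (auto simp: bipartite_def delete_edges_def)
  show "colorable (delete_edges G D) 2"
    unfolding colorable_def
  proof (intro exI[of _ "\<lambda>v. if v \<in> A then 0 else 1 :: nat"] conjI allI impI)
    fix u v assume "{u, v} \<in> edges (delete_edges G D)"
    then have "{u, v} \<in> edges G - edges D" by (simp add: delete_edges_def)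
    then obtain a b where "a \<in> A" "b \<in> B" "{u, v} = {a, b}"
      using AB(3) by blast
    then show "(if u \<in> A then 0 else 1 :: nat) \<noteq> (if v \<in> A then 0 else 1)"
      using AB(2) by (auto simp: doubleton_eq_iff)
  qed auto
next
  assume "colorable (delete_edges G D) 2"
  then obtain c :: "'a \<Rightarrow> nat" where c: "c ` verts G \<subseteq> {..<2}"
      "\<forall>u v. {u, v} \<in> edges G - edges D \<longrightarrow> c u \<noteq> c v"
    by (auto simp: colorable_def delete_edges_def)
  show "bipartite (delete_edges G D)"
    unfolding bipartite_def
  proof (rule exI[of _ "{v \<in> verts G. c v = 0}"], rule exI[of _ "{v \<in> verts G. c v = 1}"],
      intro conjI ballI)
    show "{v \<in> verts G. c v = 0} \<union> {v \<in> verts G. c v = 1} = verts (delete_edges G D)"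
      using c(1) by (force simp: delete_edges_def)
  next
    fix e assume e: "e \<in> edges (delete_edges G D)"
    then have "e \<in> nsets (verts G) 2"
      using assms by (auto simp: delete_edges_def simple_graph_def)
    then obtain x y where xy: "e = {x, y}" "x \<in> verts G" "y \<in> verts G" by (auto simp: nsets_2_eq)
    then have "c x < 2" "c y < 2" "c x \<noteq> c y"
      using c e by (auto simp: delete_edges_def)
    then consider "c x = 0" "c y = 1" | "c x = 1" "c y = 0" by linarith
    then show "\<exists>a\<in>{v \<in> verts G. c v = 0}. \<exists>b\<in>{v \<in> verts G. c v = 1}. e = {a, b}"
      by cases (use xy in \<open>auto simp: insert_commute\<close>)
  qed auto
qed

lemma finite_family_chromatic_numbers:
  assumes "simple_graph G"
  shows "finite {chromatic_number (delete_edges G D) | D. subgraph D G \<and> D \<in> F}"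
proof (rule finite_subset)
  show "{chromatic_number (delete_edges G D) | D. subgraph D G \<and> D \<in> F} \<subseteq> {..card (verts G)}"
    using colorable_card_verts[OF assms] chromatic_number_le by fastforce
qed simp

lemma family_chromatic_number_le:
  assumes "simple_graph G" "subgraph D G" "D \<in> F"
  shows "family_chromatic_number F G \<le> chromatic_number (delete_edges G D)"
  unfolding family_chromatic_number_def
  using assms by (intro Min_le finite_family_chromatic_numbers) auto

lemma empty_deletion:
  "subgraph \<lparr>verts = {}, edges = {}\<rparr> G" "\<lparr>verts = {}, edges = {}\<rparr> \<in> few_edges k"
  "delete_edges G \<lparr>verts = {}, edges = {}\<rparr> = G"
  by (auto simp: subgraph_def few_edges_def simple_graph_def delete_edges_def)

lemma family_chromatic_number_attained:
  assumes "simple_graph G"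
  obtains D where "subgraph D G" "D \<in> few_edges k"
    "chromatic_number (delete_edges G D) = family_chromatic_number (few_edges k) G"
proof -
  have "family_chromatic_number (few_edges k) G \<in>
      {chromatic_number (delete_edges G D) | D. subgraph D G \<and> D \<in> few_edges k}"
    unfolding family_chromatic_number_def
    using empty_deletion(1)[of G] empty_deletion(2)[of k] by (intro Min_in finite_family_chromatic_numbers assms) blast
  then show ?thesis using that by auto
qed

section \<open>Bounds on the anti-Ramsey number\<close>

lemma inj_on_embedding_image:
  assumes "simple_graph G" "inj_on f (verts G)"
  shows "inj_on ((`) f) (edges G)"
proof (rule inj_onI)
  fix d e assume "d \<in> edges G" "e \<in> edges G" "f ` d = f ` e"
  then show "d = e"
    using assms by (subst (asm) inj_on_image_eq_iff) (auto simp: simple_graph_def nsets_def)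
qed

text \<open>With more colors demanded than there are edges the defining condition is vacuous, so the minimum
  exists and has the property that defines it.\<close>

lemma anti_ramsey_property:
  fixes c :: "nat set \<Rightarrow> nat"
  assumes "anti_ramsey k n G \<le> card (c ` edges (complete_graph n))"
  shows "\<exists>f. embedding f G (complete_graph n) \<and>
             (\<forall>col. card {e \<in> (`) f ` edges G. c e = col} \<le> k)"
proof -
  let ?P = "\<lambda>q. q > 0 \<and> (\<forall>c :: nat set \<Rightarrow> nat. card (c ` edges (complete_graph n)) \<ge> q \<longrightarrow>
           (\<exists>f. embedding f G (complete_graph n) \<and>
                (\<forall>col. card {e \<in> (`) f ` edges G. c e = col} \<le> k)))"
  have "finite (edges (complete_graph n))"
    by (simp add: complete_graph_def finite_imp_finite_nsets)
  then have "?P (Suc (card (edges (complete_graph n))))"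
    by (meson card_image_le not_less_eq_eq zero_less_Suc)
  then have "?P (anti_ramsey k n G)"
    unfolding anti_ramsey_def by (rule LeastI)
  then show ?thesis using assms by blast
qed

lemma anti_ramsey_le:
  assumes "q > 0"
    and "\<And>c :: nat set \<Rightarrow> nat. q \<le> card (c ` edges (complete_graph n)) \<Longrightarrow>
           \<exists>f. embedding f G (complete_graph n) \<and>
                (\<forall>col. card {e \<in> (`) f ` edges G. c e = col} \<le> k)"
  shows "anti_ramsey k n G \<le> q"
  unfolding anti_ramsey_def using assms by (intro Least_le) blast

text \<open>Color the edges of the Turan graph with distinct colors and all other edges with one further color. In
  a copy of \<open>G\<close> without an overused color, at most \<open>k\<close> edges have the further color. Without these edges,
  what is left of \<open>G\<close> lies in the Turan graph and is \<open>p\<close>-colorable, contrary to the assumption on \<open>p\<close>.\<close>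

lemma anti_ramsey_gt_turan_graph:
  assumes G: "simple_graph G" and p: "1 \<le> p" "p < family_chromatic_number (few_edges k) G"
  shows "card (edges (turan_graph n p)) < anti_ramsey k n G"
proof (rule ccontr)
  assume "\<not> ?thesis"
  then have small: "anti_ramsey k n G \<le> card (edges (turan_graph n p))" by simp
  let ?T = "edges (turan_graph n p)"
  have fin: "finite (edges (complete_graph n))" "finite ?T"
    using turan_graph_edges_subset[of n p]
    by (auto simp: complete_graph_def finite_imp_finite_nsets intro: finite_subset)
  obtain h :: "nat set \<Rightarrow> nat" where h: "inj_on h ?T"
    using finite_imp_inj_to_nat_seg[OF fin(2)] by blast
  define c where "c = (\<lambda>e. if e \<in> ?T then Suc (h e) else 0)"
  have "inj_on c ?T" using h by (auto simp: c_def inj_on_def)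
  then have "card ?T = card (c ` ?T)" by (simp add: card_image)
  also have "\<dots> \<le> card (c ` edges (complete_graph n))"
    using turan_graph_edges_subset fin by (intro card_mono image_mono) auto
  finally obtain f where f: "embedding f G (complete_graph n)"
      "\<forall>col. card {e \<in> (`) f ` edges G. c e = col} \<le> k"
    using anti_ramsey_property[of k n G c] small by auto
  define D where "D = \<lparr>verts = verts G, edges = {e \<in> edges G. f ` e \<notin> ?T}\<rparr>"
  have "card (edges D) = card ((`) f ` edges D)"
    using inj_on_embedding_image[OF G, of f] f(1)
    by (subst card_image) (auto simp: embedding_def D_def inj_on_def)
  also have "(`) f ` edges D = {e \<in> (`) f ` edges G. c e = 0}"
    by (auto simp: D_def c_def)
  also have "card \<dots> \<le> k" using f(2) by blast
  finally have D: "subgraph D G" "D \<in> few_edges k"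
    using G by (auto simp: D_def subgraph_def few_edges_def simple_graph_def)
  have "colorable (delete_edges G D) p"
    unfolding colorable_def
  proof (intro exI[of _ "\<lambda>v. f v mod p"] conjI allI impI)
    show "(\<lambda>v. f v mod p) ` verts (delete_edges G D) \<subseteq> {..<p}" using p(1) by auto
  next
    fix u v assume "{u, v} \<in> edges (delete_edges G D)"
    then have "f ` {u, v} \<in> ?T" by (auto simp: delete_edges_def D_def)
    then show "f u mod p \<noteq> f v mod p" by (simp add: turan_graph_edge_iff)
  qed
  then have "family_chromatic_number (few_edges k) G \<le> p"
    using family_chromatic_number_le[OF G D] chromatic_number_le by fastforce
  then show False using p(2) by simp
qed

text \<open>The rainbow graph \<open>H\<close> contains complete classes, one for each color of \<open>G - D\<close>, and each of them has
  one vertex more than \<open>G\<close>.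
  Place every vertex of \<open>G\<close> in the class given by its color \<open>\<kappa>\<close>. The edges inside classes (the set
  \<open>inner\<close>) belong to \<open>D\<close>, so there are at most \<open>k\<close> of them; their images may have arbitrary colors. The
  edges between classes get pairwise distinct colors.

  Hence a color occurs more than \<open>k\<close> times only if all inner edges have this color \<open>a\<close>, together with
  exactly one edge \<open>b\<close> between classes. In this case take an inner edge \<open>e\<close>. The ends of \<open>b\<close> lie in
  different classes, so some end \<open>x\<close> of \<open>b\<close> is not an end of \<open>e\<close>; move \<open>x\<close> to the spare vertex of its
  class. The edge \<open>e\<close> has not moved, so the only color that can now be overused is again \<open>a\<close>. But the
  only edge of \<open>H\<close> with color \<open>a\<close> is the old image of \<open>b\<close>, which contains the vertex that \<open>x\<close> has left.\<close>

lemma rainbow_parts_k_bounded_copy: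
  fixes c :: "nat set \<Rightarrow> nat"
  assumes k: "k \<ge> 1" and G: "simple_graph G" and D: "subgraph D G" "D \<in> few_edges k"
    and col: "colorable (delete_edges G D) r"
    and H: "edges H \<subseteq> edges (complete_graph n)" "verts H = {..<n}" "inj_on c (edges H)"
    and copy: "contains_copy H (complete_multipartite r (Suc (card (verts G))))"
  shows "\<exists>f. embedding f G (complete_graph n) \<and>
             (\<forall>col. card {e \<in> (`) f ` edges G. c e = col} \<le> k)"
proof -
  let ?s = "card (verts G)"
  have finV: "finite (verts G)" and edgeG: "\<And>e. e \<in> edges G \<Longrightarrow> e \<in> nsets (verts G) 2"
    using G by (auto simp: simple_graph_def)
  have finE: "finite (edges G)"
    using G finite_subset finite_imp_finite_nsets unfolding simple_graph_def by blast
  obtain \<kappa> where \<kappa>: "\<kappa> ` verts G \<subseteq> {..<r}" "\<And>u v. {u, v} \<in> edges G - edges D \<Longrightarrow> \<kappa> u \<noteq> \<kappa> v"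
    using col by (auto simp: colorable_def delete_edges_def)
  obtain \<phi> where \<phi>: "embedding \<phi> (complete_multipartite r (Suc ?s)) H"
    using copy by (auto simp: contains_copy_def)
  obtain h where h: "bij_betw h (verts G) {0..<?s}"
    using ex_bij_betw_finite_nat[OF finV] by blast
  define inner where "inner = {e \<in> edges G. \<forall>u\<in>e. \<forall>v\<in>e. \<kappa> u = \<kappa> v}"
  have inner_subset: "inner \<subseteq> edges D"
  proof
    fix e assume e: "e \<in> inner"
    then have "e \<in> nsets (verts G) 2" using edgeG unfolding inner_def by blast
    then obtain u v where uv: "e = {u, v}" by (auto simp: nsets_2_eq)
    have "\<kappa> u = \<kappa> v" "{u, v} \<in> edges G" using e unfolding inner_def uv by blast+
    then show "e \<in> edges D" using \<kappa>(2) uv by blast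
  qed
  have finD: "finite (edges D)"
    using D(1) finE finite_subset by (auto simp: subgraph_def)
  have card_inner: "card inner \<le> k"
    using card_mono[OF finD inner_subset] D(2) by (simp add: few_edges_def)
  have fin_inner: "finite inner" using finE by (simp add: inner_def)
  define place where "place = (\<lambda>g v. \<phi> (\<kappa> v, g v))"
  have place_embedding: "embedding (place g) G (complete_graph n)"
      "\<And>e. e \<in> edges G - inner \<Longrightarrow> place g ` e \<in> edges H"
    if g: "inj_on g (verts G)" "g ` verts G \<subseteq> {..?s}" for g
  proof -
    have sub: "(\<kappa> v, g v) \<in> verts (complete_multipartite r (Suc ?s))" if "v \<in> verts G" for v
      using \<kappa>(1) g(2) that by (auto simp: complete_multipartite_def less_Suc_eq_le)
    have inj: "inj_on (place g) (verts G)"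
    proof (rule inj_onI)
      fix u v assume uv: "u \<in> verts G" "v \<in> verts G" "place g u = place g v"
      then have "(\<kappa> u, g u) = (\<kappa> v, g v)"
        using \<phi> sub unfolding embedding_def place_def inj_on_def by blast
      then show "u = v" using g(1) uv by (auto simp: inj_on_def)
    qed
    have im: "place g v < n" if "v \<in> verts G" for v
      using \<phi> sub[OF that] H(2) unfolding embedding_def place_def by blast
    have "place g ` e \<in> edges (complete_graph n)" if e: "e \<in> edges G" for e
    proof -
      obtain u v where "e = {u, v}" "u \<in> verts G" "v \<in> verts G" "u \<noteq> v"
        using edgeG[OF e] by (auto simp: nsets_2_eq)
      then show ?thesis
        using im inj by (auto simp: complete_graph_def inj_on_def)
    qed
    then show "embedding (place g) G (complete_graph n)"
      using inj im by (auto simp: embedding_def complete_graph_def)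
    fix e assume e: "e \<in> edges G - inner"
    then obtain u v where uv: "e = {u, v}" "u \<in> verts G" "v \<in> verts G"
      using edgeG[of e] by (auto simp: nsets_2_eq)
    then have "\<kappa> u \<noteq> \<kappa> v" using e by (auto simp: inner_def)
    then have "{(\<kappa> u, g u), (\<kappa> v, g v)} \<in> edges (complete_multipartite r (Suc ?s))"
      using sub[OF uv(2)] sub[OF uv(3)] unfolding complete_multipartite_def by fastforce
    then have "\<phi> ` {(\<kappa> u, g u), (\<kappa> v, g v)} \<in> edges H"
      using \<phi> unfolding embedding_def by blast
    then show "place g ` e \<in> edges H" by (simp add: place_def uv(1))
  qed
  \<comment> \<open>At most k edges are inner, and H contributes at most one edge of each color, so a color
      reaches k + 1 edges only by using up both supplies.\<close>
  have overfull: "\<exists>e\<in>edges G - inner. c (place g ` e) = col \<and> (\<forall>d\<in>inner. c (place g ` d) = col)"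
    if g: "inj_on g (verts G)" "g ` verts G \<subseteq> {..?s}"
      and bad: "k < card {e \<in> (`) (place g) ` edges G. c e = col}" for g col
  proof -
    let ?M = "{d \<in> inner. c (place g ` d) = col}"
    let ?X = "{e \<in> edges G - inner. c (place g ` e) = col}"
    have "{e \<in> (`) (place g) ` edges G. c e = col} = (`) (place g) ` (?M \<union> ?X)"
      by (auto simp: inner_def)
    then have "k < card ((`) (place g) ` (?M \<union> ?X))" using bad by simp
    also have "\<dots> \<le> card (?M \<union> ?X)"
      using fin_inner finE by (intro card_image_le) auto
    also have "\<dots> \<le> card ?M + card ?X" by (rule card_Un_le)
    finally have sum: "k < card ?M + card ?X" .
    have "card ?X \<le> 1"
    proof -
      have "d = e" if "d \<in> ?X" "e \<in> ?X" for d e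
      proof -
        have "place g ` d = place g ` e"
          using that place_embedding(2)[OF g] H(3) by (auto simp: inj_on_def)
        then show "d = e"
          using inj_on_embedding_image[OF G, of "place g"] place_embedding(1)[OF g] that
          unfolding embedding_def inj_on_def by blast
      qed
      then show ?thesis using finE by (simp add: card_le_Suc0_iff_eq)
    qed
    moreover have "card ?M \<le> card inner" using fin_inner by (intro card_mono) auto
    ultimately have eq: "card ?M = card inner" and "card ?X \<noteq> 0"
      using sum card_inner by linarith+
    then have "?X \<noteq> {}" by (metis card.empty)
    moreover have "?M = inner" using fin_inner eq by (intro card_subset_eq) auto
    ultimately show ?thesis by blast
  qed
  have h_good: "inj_on h (verts G)" "h ` verts G \<subseteq> {..?s}"
    using h by (auto simp: bij_betw_def)
  show ?thesis
  proof (cases "\<forall>col. card {e \<in> (`) (place h) ` edges G. c e = col} \<le> k")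
    case True
    then show ?thesis using place_embedding(1)[OF h_good] by blast
  next
    case False
    then obtain a where bad: "k < card {e \<in> (`) (place h) ` edges G. c e = a}"
      by (auto simp: not_le)
    from overfull[OF h_good bad] obtain b where b: "b \<in> edges G - inner" "c (place h ` b) = a"
        "\<forall>d\<in>inner. c (place h ` d) = a"
      by blast
    show ?thesis
    proof (cases "inner = {}")
      case True
      have "card {e \<in> (`) (place h) ` edges G. c e = col} \<le> k" for col
      proof -
        have "inj_on c ((`) (place h) ` edges G)"
          using place_embedding(2)[OF h_good] True
          by (intro inj_on_subset[OF H(3)]) auto
        then have "d = e" if "d \<in> {e \<in> (`) (place h) ` edges G. c e = col}"
            "e \<in> {e \<in> (`) (place h) ` edges G. c e = col}" for d e
          using that unfolding inj_on_def by blast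
        then have "card {e \<in> (`) (place h) ` edges G. c e = col} \<le> 1"
          using finE by (simp only: One_nat_def) (subst card_le_Suc0_iff_eq, auto)
        then show ?thesis using k by linarith
      qed
      then show ?thesis using bad by (meson not_le)
    next
      case False
      then obtain e where e: "e \<in> inner" by blast
      have "\<not> b \<subseteq> e"
      proof
        assume "b \<subseteq> e"
        then have "b \<in> inner" using b(1) e unfolding inner_def by blast
        then show False using b(1) by blast
      qed
      then obtain x where x: "x \<in> b" "x \<notin> e" by blast
      have xG: "x \<in> verts G" using b x edgeG[of b] by (auto simp: nsets_def)
      \<comment> \<open>The positions h use only the indices below ?s, so the index ?s is free in every class.\<close>
      define g where "g = h(x := ?s)"
      have h_less: "h v < ?s" if "v \<in> verts G" for v
        using bij_betw_apply[OF h that] by simp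
      have g: "inj_on g (verts G)" "g ` verts G \<subseteq> {..?s}"
      proof -
        have "?s \<notin> h ` verts G" using h_less by fastforce
        then show "inj_on g (verts G)"
          unfolding g_def using h_good(1) by (rule inj_on_fun_updI[rotated])
        show "g ` verts G \<subseteq> {..?s}"
          unfolding g_def using h_good(2) by auto
      qed
      have ge: "place g ` e = place h ` e"
        using x(2) by (auto simp: place_def g_def intro!: image_cong)
      have "\<not> k < card {e' \<in> (`) (place g) ` edges G. c e' = col}" for col
      proof
        assume "k < card {e' \<in> (`) (place g) ` edges G. c e' = col}"
        from overfull[OF g this] obtain b' where b': "b' \<in> edges G - inner" "c (place g ` b') = col"
            "\<forall>d\<in>inner. c (place g ` d) = col"
          by blast
        have "col = a" using b'(3) b(3) e ge by auto
        then have "place g ` b' = place h ` b"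
          using b b' place_embedding(2)[OF h_good] place_embedding(2)[OF g] H(3)
          by (auto simp: inj_on_def)
        then have "place h x \<in> place g ` b'" using x by blast
        then obtain y where y: "y \<in> b'" "place h x = place g y" by blast
        have yG: "y \<in> verts G" using b' y edgeG[of b'] by (auto simp: nsets_def)
        have "(\<kappa> x, h x) = (\<kappa> y, g y)"
        proof -
          have "(\<kappa> x, h x) \<in> verts (complete_multipartite r (Suc ?s))"
              "(\<kappa> y, g y) \<in> verts (complete_multipartite r (Suc ?s))"
            using \<kappa>(1) h_good(2) g(2) xG yG by (auto simp: complete_multipartite_def less_Suc_eq_le)
          then show ?thesis
            using \<phi> y(2) unfolding embedding_def inj_on_def place_def by blast
        qed
        then have "h x = g y" by simp
        then show False
          using h_less[OF xG] inj_on_eq_iff[OF h_good(1) xG yG]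
          by (cases "y = x") (simp_all add: g_def)
      qed
      then show ?thesis using place_embedding(1)[OF g] by (meson not_le)
    qed
  qed
qed

text \<open>For the upper bound choose one edge of every color. These edges form a rainbow graph with
  \<open>(1 - 1/p + \<epsilon>) n\<^sup>2 / 2\<close> edges, in which the Erdos-Stone theorem provides \<open>p + 1\<close> classes large enough for
  \<open>rainbow_parts_k_bounded_copy\<close>.\<close>

theorem anti_ramsey_asymp:
  fixes G :: "'a sgraph"
  assumes k: "k \<ge> 1" and G: "simple_graph G"
    and r: "family_chromatic_number (few_edges k) G = Suc p" and p: "p \<ge> 2"
  shows "(\<lambda>n. real (anti_ramsey k n G)) \<sim>[at_top] (\<lambda>n. (real p - 1) / (2 * real p) * real n ^ 2)"
proof (rule asymp_equiv_quadraticI)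
  show "(real p - 1) / (2 * real p) > 0" using p by simp
next
  fix n
  have "card (edges (turan_graph n p)) < anti_ramsey k n G"
    using p r by (intro anti_ramsey_gt_turan_graph G) auto
  then show "(real p - 1) / (2 * real p) * (real n * (real n - 1)) \<le> real (anti_ramsey k n G)"
    using card_turan_graph_edges_ge[of p n] p by linarith
next
  fix \<epsilon> :: real assume \<epsilon>: "\<epsilon> > 0"
  let ?C = "(real p - 1) / (2 * real p)"
  have p1: "p \<ge> 1" and C: "?C > 0" using p by auto
  obtain D where D: "subgraph D G" "D \<in> few_edges k"
      "chromatic_number (delete_edges G D) = Suc p"
    using family_chromatic_number_attained[OF G] r by metis
  have col: "colorable (delete_edges G D) (Suc p)"
    using colorable_chromatic_number[OF G, of D] D(3) by simp
  have \<epsilon>2: "\<epsilon> / 2 > 0" using \<epsilon> by simp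
  from erdos_stone[OF \<epsilon>2 p1, of "Suc (card (verts G))"]
  obtain N where "\<forall>H::nat sgraph. simple_graph H \<and> N \<le> card (verts H) \<and>
           (?C + \<epsilon> / 2) * real (card (verts H)) ^ 2 \<le> card (edges H) \<longrightarrow>
           contains_copy H (complete_multipartite (Suc p) (Suc (card (verts G))))" ..
  then have N: "\<And>H::nat sgraph. simple_graph H \<Longrightarrow> N \<le> card (verts H) \<Longrightarrow>
           (?C + \<epsilon> / 2) * real (card (verts H)) ^ 2 \<le> card (edges H) \<Longrightarrow>
           contains_copy H (complete_multipartite (Suc p) (Suc (card (verts G))))" by simp
  obtain N1 :: nat where N1: "1 \<le> real N1 * (\<epsilon> / 2)"
    using reals_Archimedean3[OF \<epsilon>2] by (meson less_imp_le)
  have "real (anti_ramsey k n G) \<le> (?C + \<epsilon>) * real n ^ 2" if n: "n \<ge> max N (max N1 1)" for n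
  proof -
    let ?x = "(?C + \<epsilon> / 2) * real n ^ 2"
    \<comment> \<open>Half of \<epsilon> absorbs the rounding to an integer number of colors.\<close>
    define q where "q = nat \<lceil>?x\<rceil>"
    have x0: "?x > 0" using C \<epsilon> n by (intro mult_pos_pos) auto
    have q: "?x \<le> real q" "real q \<le> ?x + 1" "q > 0"
      using x0 unfolding q_def by linarith+
    have "anti_ramsey k n G \<le> q"
    proof (rule anti_ramsey_le[OF q(3)])
      fix c :: "nat set \<Rightarrow> nat" assume many: "q \<le> card (c ` edges (complete_graph n))"
      obtain E where E: "E \<subseteq> edges (complete_graph n)" "inj_on c E"
          "c ` edges (complete_graph n) = c ` E"
        using subset_image_inj[of "c ` edges (complete_graph n)" c "edges (complete_graph n)"] by auto
      let ?H = "\<lparr>verts = {..<n}, edges = E\<rparr>"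
      have "q \<le> card E" using many E by (simp add: card_image)
      then have "?x \<le> card E" using q(1) by linarith
      then have "contains_copy ?H (complete_multipartite (Suc p) (Suc (card (verts G))))"
        using E n by (intro N) (auto simp: simple_graph_def complete_graph_def)
      then show "\<exists>f. embedding f G (complete_graph n) \<and>
                (\<forall>col. card {e \<in> (`) f ` edges G. c e = col} \<le> k)"
        using E by (intro rainbow_parts_k_bounded_copy[OF k G D(1,2) col, of ?H]) auto
    qed
    moreover have "1 \<le> \<epsilon> / 2 * real n ^ 2"
    proof -
      have "real N1 \<le> real n" "real n \<le> real n ^ 2"
        using n by (auto simp: power2_eq_square)
      then have "real N1 * (\<epsilon> / 2) \<le> real n ^ 2 * (\<epsilon> / 2)"
        using \<epsilon> by (intro mult_right_mono) auto
      then show ?thesis using N1 by (simp add: mult.commute)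
    qed
    ultimately show ?thesis using q(2) by (simp add: algebra_simps)
  qed
  then show "eventually (\<lambda>n. real (anti_ramsey k n G) \<le> (?C + \<epsilon>) * real n ^ 2) at_top"
    by (rule eventually_mono[OF eventually_ge_at_top[of "max N (max N1 1)"]])
qed

section \<open>Graphs of family chromatic number at least three\<close>

lemma family_chromatic_number_ge_3:
  assumes "simple_graph G"
    and "\<nexists>D. subgraph D G \<and> D \<in> few_edges k \<and> bipartite (delete_edges G D)"
  shows "3 \<le> family_chromatic_number (few_edges k) G"
proof (rule ccontr)
  assume "\<not> ?thesis"
  then have le: "family_chromatic_number (few_edges k) G \<le> 2" by simp
  obtain D where D: "subgraph D G" "D \<in> few_edges k"
      "chromatic_number (delete_edges G D) = family_chromatic_number (few_edges k) G"
    using family_chromatic_number_attained[OF assms(1)] by metis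
  then have "colorable (delete_edges G D) 2"
    using colorable_mono[OF colorable_chromatic_number[OF assms(1)]] le by metis
  then show False using assms D bipartite_iff_colorable_2 by blast
qed

text \<open>The complete multipartite graph contains the \<open>k + 1\<close> disjoint cliques \<open>{(i, j) | i < q}\<close>, one for each
  \<open>j \<le> k\<close>. At most \<open>k\<close> deleted edges leave one of them intact, and it needs \<open>q\<close> colors.\<close>

lemma complete_multipartite_resists_deletion:
  assumes G: "simple_graph G" and copy: "contains_copy G (complete_multipartite q (k + 1))"
    and D: "subgraph D G" "D \<in> few_edges k" and col: "colorable (delete_edges G D) r"
  shows "q \<le> r"
proof -
  obtain \<phi> where \<phi>: "embedding \<phi> (complete_multipartite q (k + 1)) G"
    using copy by (auto simp: contains_copy_def)
  obtain c :: "'a \<Rightarrow> nat" where c: "c ` verts G \<subseteq> {..<r}"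
      "\<And>u v. {u, v} \<in> edges G \<Longrightarrow> {u, v} \<notin> edges D \<Longrightarrow> c u \<noteq> c v"
    using col by (auto simp: colorable_def delete_edges_def)
  have inj: "\<phi> (i, j) = \<phi> (i', j') \<longleftrightarrow> i = i' \<and> j = j'"
    if "i < q" "i' < q" "j \<le> k" "j' \<le> k" for i i' j j'
  proof -
    have "inj_on \<phi> ({..<q} \<times> {..<k + 1})"
      using \<phi> by (simp add: embedding_def complete_multipartite_def)
    then show ?thesis
      using that inj_on_eq_iff[of \<phi> "{..<q} \<times> {..<k + 1}" "(i, j)" "(i', j')"] by auto
  qed
  have edge: "{\<phi> (i, j), \<phi> (i', j')} \<in> edges G"
    if "i < q" "i' < q" "j \<le> k" "j' \<le> k" "i \<noteq> i'" for i i' j j'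
  proof -
    have "{(i, j), (i', j')} \<in> edges (complete_multipartite q (k + 1))"
      using that unfolding complete_multipartite_def by fastforce
    then have "\<phi> ` {(i, j), (i', j')} \<in> edges G"
      using \<phi> unfolding embedding_def by blast
    then show ?thesis by simp
  qed
  \<comment> \<open>Otherwise picking a deleted edge from each clique gives k + 1 distinct deleted edges.\<close>
  have "\<exists>j\<le>k. \<forall>i<q. \<forall>i'<q. i \<noteq> i' \<longrightarrow> {\<phi> (i, j), \<phi> (i', j)} \<notin> edges D"
  proof (rule ccontr)
    assume "\<not> ?thesis"
    then have "\<forall>j\<in>{..k}. \<exists>e. e \<in> edges D \<and> (\<exists>i<q. \<exists>i'<q. e = {\<phi> (i, j), \<phi> (i', j)})"
      by (fastforce simp: Bex_def)
    then obtain e where e: "\<And>j. j \<le> k \<Longrightarrow> e j \<in> edges D \<and> (\<exists>i<q. \<exists>i'<q. e j = {\<phi> (i, j), \<phi> (i', j)})"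
      by (auto dest!: bchoice)
    have "inj_on e {..k}"
    proof (rule inj_onI)
      fix j j' assume j: "j \<in> {..k}" "j' \<in> {..k}" "e j = e j'"
      obtain i1 i2 where "i1 < q" "i2 < q" "e j = {\<phi> (i1, j), \<phi> (i2, j)}"
        using e[of j] j by auto
      moreover obtain i3 i4 where "i3 < q" "i4 < q" "e j' = {\<phi> (i3, j'), \<phi> (i4, j')}"
        using e[of j'] j by auto
      ultimately show "j = j'" using j inj by (auto simp: doubleton_eq_iff)
    qed
    moreover have "e ` {..k} \<subseteq> edges D" using e by auto
    moreover have "finite (edges D)"
      using D(2) by (auto simp: few_edges_def simple_graph_def intro: finite_subset finite_imp_finite_nsets)
    ultimately have "card {..k} \<le> card (edges D)" by (intro card_inj_on_le)
    then show False using D(2) by (simp add: few_edges_def)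
  qed
  then obtain j where j: "j \<le> k" "\<And>i i'. i < q \<Longrightarrow> i' < q \<Longrightarrow> i \<noteq> i' \<Longrightarrow> {\<phi> (i, j), \<phi> (i', j)} \<notin> edges D"
    by blast
  have "inj_on (\<lambda>i. c (\<phi> (i, j))) {..<q}"
  proof (rule inj_onI, rule ccontr)
    fix i i' assume "i \<in> {..<q}" "i' \<in> {..<q}" "c (\<phi> (i, j)) = c (\<phi> (i', j))" "i \<noteq> i'"
    then show False using c(2)[OF edge[of i i' j j] j(2)[of i i']] j(1) by auto
  qed
  moreover have "(\<lambda>i. c (\<phi> (i, j))) ` {..<q} \<subseteq> {..<r}"
  proof
    fix y assume "y \<in> (\<lambda>i. c (\<phi> (i, j))) ` {..<q}"
    then obtain i where i: "i < q" "y = c (\<phi> (i, j))" by auto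
    then have "\<phi> (i, j) \<in> verts G"
      using \<phi> j(1) by (fastforce simp: embedding_def complete_multipartite_def)
    then show "y \<in> {..<r}" using c(1) i by auto
  qed
  ultimately have "card {..<q} \<le> card {..<r}" by (intro card_inj_on_le) auto
  then show ?thesis by simp
qed

lemma family_chromatic_number_multipartite:
  assumes G: "simple_graph G" and copy: "contains_copy G (complete_multipartite q (k + 1))"
    and q: "chromatic_number G = q"
  shows "family_chromatic_number (few_edges k) G = q"
proof (rule antisym)
  show "family_chromatic_number (few_edges k) G \<le> q"
    using family_chromatic_number_le[OF G empty_deletion(1,2)] q by (simp add: empty_deletion(3))
  obtain D where D: "subgraph D G" "D \<in> few_edges k"
      "chromatic_number (delete_edges G D) = family_chromatic_number (few_edges k) G"
    using family_chromatic_number_attained[OF G] by metis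
  show "q \<le> family_chromatic_number (few_edges k) G"
    using complete_multipartite_resists_deletion[OF G copy D(1,2) colorable_chromatic_number[OF G]] D(3)
    by simp
qed

theorem theorem5p7:
  fixes k :: nat and G :: "'a sgraph"
  assumes "k \<ge> 1" and "simple_graph G"
  shows
    "((\<nexists>D. subgraph D G \<and> D \<in> few_edges k \<and> bipartite (delete_edges G D)) \<longrightarrow>
        (\<lambda>n. real (anti_ramsey k n G)) \<sim>[at_top]
        (\<lambda>n. real (turan_number n (complete_graph (family_chromatic_number (few_edges k) G)))))
     \<and>
     (\<forall>q. chromatic_number G = q \<and> q \<ge> 3 \<and> contains_copy G (complete_multipartite q (k + 1)) \<longrightarrow>
        (\<lambda>n. real (anti_ramsey k n G)) \<sim>[at_top] (\<lambda>n. real (turan_number n (complete_graph q))) \<and>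
        (\<lambda>n. real (turan_number n (complete_graph q))) \<sim>[at_top]
          (\<lambda>n. (real q - 2) / (2 * real q - 2) * real n ^ 2))"
proof -
  have ar: "(\<lambda>n. real (anti_ramsey k n G)) \<sim>[at_top] (\<lambda>n. real (turan_number n (complete_graph q)))"
    and tu: "(\<lambda>n. real (turan_number n (complete_graph q))) \<sim>[at_top]
          (\<lambda>n. (real q - 2) / (2 * real q - 2) * real n ^ 2)"
    if q: "family_chromatic_number (few_edges k) G = q" "q \<ge> 3" for q
  proof -
    obtain p where p: "q = Suc p" "p \<ge> 2" using q(2) by (cases q) auto
    show "(\<lambda>n. real (anti_ramsey k n G)) \<sim>[at_top] (\<lambda>n. real (turan_number n (complete_graph q)))"
      unfolding p(1)
    proof (rule asymp_equiv_trans)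
      show "(\<lambda>n. real (anti_ramsey k n G)) \<sim>[at_top] (\<lambda>n. (real p - 1) / (2 * real p) * real n ^ 2)"
        using assms q p by (intro anti_ramsey_asymp) simp_all
      show "(\<lambda>n. (real p - 1) / (2 * real p) * real n ^ 2) \<sim>[at_top]
          (\<lambda>n. real (turan_number n (complete_graph (Suc p))))"
        using turan_number_clique_asymp[OF p(2)] by (rule asymp_equiv_symI)
    qed
    show "(\<lambda>n. real (turan_number n (complete_graph q))) \<sim>[at_top]
          (\<lambda>n. (real q - 2) / (2 * real q - 2) * real n ^ 2)"
      using turan_number_clique_asymp[OF p(2)] by (simp add: p(1) algebra_simps)
  qed
  show ?thesis
  proof (intro conjI impI allI, goal_cases)
    case 1
    then show ?case
      by (intro ar refl family_chromatic_number_ge_3 assms)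
  next
    case (2 q)
    then show ?case
      by (intro ar family_chromatic_number_multipartite assms) auto
  next
    case (3 q)
    then show ?case
      by (intro tu family_chromatic_number_multipartite assms) auto
  qed
qed

end
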